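(* Let $a\in\mathbb{R}^k$, $A\in\mathbb{R}^{k\times d}$ with $P=\{x\in\mathbb{R}^d : a-Ax\ge 0\}$ a nonempty polytope, and let $B=[b^{(1)},\ldots,b^{(l)}]\in\mathbb{R}^{d\times l}$ with $Q=\operatorname{conv}(b^{(1)},\ldots,b^{(l)})$ having $0$ in its interior. With $\mu(t)$ and $\mu^*$ as defined in the context: (1) If $\mu(t)\le 1$ for some integer $t\ge 2$, then $P\subseteq Q$. (2) The sequence $\mu(t)$ converges from above to $\mu^*$ as $t\to\infty$. (3) If $P$ is strongly contained in $Q$, then the hierarchy decides the containment problem in finitely many steps: there exists an integer $t\ge 2$ with $\mu(t)\le 1$.
   Context: Let $x=(x_1,\ldots,x_d)$, $z=(z_1,\ldots,z_d)$ be variables, $Q^\circ=\{z : \mathbb{1}_l-B^Tz\ge 0\}$ ($\mathbb{1}_l$ the all-ones vector), and $\mu^*=\sup\{x^Tz : (x,z)\in P\times Q^\circ\}$. Let $g_1,\ldots,g_{k+l}\in\mathbb{R}[x,z]$ be the affine polynomials $(a-Ax)_i$, $i=1,\ldots,k$, and $(\mathbb{1}_l-B^Tz)_j$, $j=1,\ldots,l$. Let $\Sigma[x,z]$ be the set of sums of squares of polynomials. For an integer $t$, the truncated quadratic module is $\mathrm{QM}_t(A,B)=\{\sigma_0+\sum_{i=1}^{k+l}\sigma_i g_i : \sigma_i\in\Sigma[x,z],\ \deg\sigma_0\le 2t,\ \deg(\sigma_ig_i)\le 2t\}$, and $\mu(t)=\inf\{\mu\in\mathbb{R} : \mu-x^Tz\in\mathrm{QM}_t(A,B)\}$.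 $P$ is strongly contained in $Q$ if $P\subseteq Q$ and $\partial P\cap\partial Q=\emptyset$. *)

theory Defs
  imports "HOL-Analysis.Analysis" "HOL-Library.Poly_Mapping"
begin

text \<open>
  Real polynomials with variables indexed by \<open>'v\<close>: finitely supported coefficient functions on
  monomials, with the convolution product of \<open>Poly_Mapping\<close>.  The ring \<open>\<real>[x,z]\<close> is
  \<open>('d + 'd) rpoly\<close>, where \<open>Inl i\<close> stands for \<open>x\<^sub>i\<close> and \<open>Inr i\<close> for \<open>z\<^sub>i\<close>.
\<close>

type_synonym 'v rpoly = "('v \<Rightarrow>\<^sub>0 nat) \<Rightarrow>\<^sub>0 real"

definition Const :: "real \<Rightarrow> 'v rpoly" where
  "Const c = Poly_Mapping.single 0 c"

definition Var :: "'v \<Rightarrow> 'v rpoly" where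
  "Var v = Poly_Mapping.single (Poly_Mapping.single v 1) 1"

definition monom_degree :: "('v \<Rightarrow>\<^sub>0 nat) \<Rightarrow> nat" where
  "monom_degree m = (\<Sum>v\<in>Poly_Mapping.keys m. Poly_Mapping.lookup m v)"

text \<open>Total degree; the zero polynomial gets degree 0, which is harmless since only upper
  bounds by natural numbers are used.\<close>

definition total_degree :: "'v rpoly \<Rightarrow> nat" where
  "total_degree p = Max (insert 0 (monom_degree ` Poly_Mapping.keys p))"

definition SOS :: "'v rpoly set" where
  "SOS = {p. \<exists>qs. p = (\<Sum>q\<leftarrow>qs. q\<^sup>2)}"

definition polyP :: "real^'k \<Rightarrow> real^'d^'k \<Rightarrow> (real^'d) set" where
  "polyP a A = {x. 0 \<le> a - A *v x}"

definition polyQ :: "real^'l^'d \<Rightarrow> (real^'d) set" where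
  "polyQ B = convex hull (columns B)"

definition polarQ :: "real^'l^'d \<Rightarrow> (real^'d) set" where
  "polarQ B = {z. 0 \<le> 1 - transpose B *v z}"

definition mu_star :: "real^'k \<Rightarrow> real^'d^'k \<Rightarrow> real^'l^'d \<Rightarrow> ereal" where
  "mu_star a A B = (SUP (x, z) \<in> polyP a A \<times> polarQ B. ereal (x \<bullet> z))"

text \<open>The affine generators \<open>(a - A x)\<^sub>i\<close> and \<open>(1 - B\<^sup>T z)\<^sub>j\<close>.\<close>

fun gen :: "real^'k \<Rightarrow> real^'d^'k \<Rightarrow> real^'l^'d \<Rightarrow> 'k + 'l \<Rightarrow> ('d + 'd) rpoly" where
  "gen a A B (Inl i) = Const (a $ i) - (\<Sum>m\<in>UNIV. Const (A $ i $ m) * Var (Inl m))"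
| "gen a A B (Inr j) = Const 1 - (\<Sum>m\<in>UNIV. Const (B $ m $ j) * Var (Inr m))"

definition QM :: "nat \<Rightarrow> real^'k \<Rightarrow> real^'d^'k \<Rightarrow> real^'l^'d \<Rightarrow> ('d + 'd) rpoly set" where
  "QM t a A B =
    {\<sigma>\<^sub>0 + (\<Sum>i\<in>UNIV. \<sigma> i * gen a A B i) | \<sigma>\<^sub>0 \<sigma>.
       \<sigma>\<^sub>0 \<in> SOS \<and> (\<forall>i. \<sigma> i \<in> SOS) \<and>
       total_degree \<sigma>\<^sub>0 \<le> 2 * t \<and> (\<forall>i. total_degree (\<sigma> i * gen a A B i) \<le> 2 * t)}"

definition bilin :: "('d::finite + 'd) rpoly" where
  "bilin = (\<Sum>m\<in>UNIV. Var (Inl m) * Var (Inr m))"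

text \<open>Extended-real valued, so that the infimum of the empty set is \<open>\<infinity>\<close>.\<close>

definition mu :: "real^'k \<Rightarrow> real^'d^'k \<Rightarrow> real^'l^'d \<Rightarrow> nat \<Rightarrow> ereal" where
  "mu a A B t = Inf {ereal \<mu> | \<mu>. Const \<mu> - bilin \<in> QM t a A B}"

definition strongly_contained :: "'a::topological_space set \<Rightarrow> 'a set \<Rightarrow> bool" where
  "strongly_contained P Q \<longleftrightarrow> P \<subseteq> Q \<and> frontier P \<inter> frontier Q = {}"

end

theory Submission
  imports Defs
begin

text \<open>
  The heart of the matter is Putinar's Positivstellensatz for the generators \<open>g\<^sub>i\<close>, proved here by
  elementary means.  Since \<open>P\<close> is bounded and \<open>0\<close> is interior to \<open>Q\<close>, the rows of \<open>A\<close> and the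
  columns of \<open>B\<close> each generate \<open>\<real>\<^sup>d\<close> as a cone; hence \<open>c \<plusminus> x\<^sub>m\<close> and \<open>c \<plusminus> z\<^sub>m\<close> are nonnegative
  combinations of the \<open>g\<^sub>i\<close>, and \<open>N = R - \<Sum> x\<^sub>m\<^sup>2 - \<Sum> z\<^sub>m\<^sup>2\<close> lies in the quadratic module.
  The quadratic module of the single polynomial \<open>N\<close> is closed under products and contains the affine
  forms defining a box around the ball \<open>N \<ge> 0\<close>, so by Bernstein expansion it contains every
  polynomial that is positive on that box.  Finally, a polynomial that is positive only where all
  \<open>g\<^sub>i \<ge> 0\<close> becomes positive on the whole box after subtracting a suitable element of the
  quadratic module.  Applied to \<open>\<mu> - x\<^sup>Tz\<close> with \<open>\<mu> > \<mu>\<^sup>*\<close> this gives the convergence; the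
  containment statements then follow from the bipolar theorem for \<open>Q\<close>.
\<close>

section \<open>Polynomials and their evaluation\<close>

text \<open>The values range over any commutative monoid because the rule is applied on two levels:
  to polynomials, and to their exponent vectors, which are finitely supported maps as well.\<close>

lemma rpoly_add_induct [case_names single add]:
  fixes p :: "'a \<Rightarrow>\<^sub>0 'b::comm_monoid_add"
  assumes single: "\<And>m c. P (Poly_Mapping.single m c)"
    and add: "\<And>p q. P p \<Longrightarrow> P q \<Longrightarrow> P (p + q)"
  shows "P p"
proof (induction p rule: Poly_Mapping.update_induct)
  case const
  then show ?case using single[of undefined 0] by simp
next
  case (update f a b)
  have "Poly_Mapping.update a b f = f + Poly_Mapping.single a b"
    using update(1) by (intro poly_mapping_eqI)
      (auto simp: Poly_Mapping.lookup_update lookup_add lookup_single when_def in_keys_iff)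
  then show ?case using add[OF update(3) single[of a b]] by simp
qed

lemma Const_0: "Const 0 = 0"
  and Const_1: "Const 1 = 1"
  and Const_add: "Const (a + b) = Const a + Const b"
  and Const_diff: "Const (a - b) = Const a - Const b"
  and Const_mult: "Const (a * b) = Const a * Const b"
  by (simp_all add: Const_def single_add single_diff mult_single)

lemma Const_prod: "Const (\<Prod>i\<in>I. f i) = (\<Prod>i\<in>I. Const (f i))"
  by (induction I rule: infinite_finite_induct) (simp_all add: Const_1 Const_mult)

lemma Const_sum: "Const (\<Sum>i\<in>I. f i) = (\<Sum>i\<in>I. Const (f i))"
  by (induction I rule: infinite_finite_induct) (simp_all add: Const_0 Const_add)

lemma Const_power2: "Const (a\<^sup>2) = (Const a)\<^sup>2"
  by (simp add: power2_eq_square Const_mult)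

lemma Const_of_nat: "Const (of_nat n) = of_nat n"
  by (induction n) (simp_all add: Const_0 Const_1 Const_add)

lemma single_monom:
  "Poly_Mapping.single (Poly_Mapping.single v n) (1::real) = Var v ^ n"
proof (induction n)
  case (Suc n)
  have "Poly_Mapping.single (Poly_Mapping.single v (Suc n)) (1::real) =
    Poly_Mapping.single (Poly_Mapping.single v n + Poly_Mapping.single v 1) (1 * 1)"
    by (simp add: single_add[symmetric])
  also have "\<dots> = Poly_Mapping.single (Poly_Mapping.single v n) 1 * Var v"
    by (simp only: mult_single[symmetric] Var_def)
  finally show ?case by (simp add: Suc mult.commute)
qed simp

text \<open>Two nested additive inductions: sums of polynomials reduce to one term, and sums of
  exponent vectors become products, which leaves powers of one variable.\<close>

lemma rpoly_induct [case_names Const Var add mult]: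
  fixes p :: "'v rpoly"
  assumes Const: "\<And>c. P (Const c)" and Var: "\<And>v. P (Var v)"
    and add: "\<And>p q. P p \<Longrightarrow> P q \<Longrightarrow> P (p + q)"
    and mult: "\<And>p q. P p \<Longrightarrow> P q \<Longrightarrow> P (p * q)"
  shows "P p"
proof (induction p rule: rpoly_add_induct)
  case (single m c)
  have pow: "P (Var v ^ n)" for v n
  proof (induction n)
    case 0 show ?case using Const[of 1] by (simp add: Const_1)
  next
    case (Suc n) show ?case using mult[OF Var Suc] by simp
  qed
  have "P (Poly_Mapping.single m 1)"
  proof (induction m rule: rpoly_add_induct)
    case (single v n)
    show ?case by (simp add: single_monom pow)
  next
    case (add m n)
    then show ?case using mult[OF add] by (simp add: mult_single)
  qed
  then have "P (Const c * Poly_Mapping.single m 1)" using Const mult by blast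
  then show ?case by (simp add: Const_def mult_single)
qed (rule add)

section \<open>Evaluation of polynomials at real points\<close>

definition eval_monom :: "real^'v \<Rightarrow> ('v \<Rightarrow>\<^sub>0 nat) \<Rightarrow> real" where
  "eval_monom w m = (\<Prod>v\<in>UNIV. w $ v ^ Poly_Mapping.lookup m v)"

definition evalp :: "'v rpoly \<Rightarrow> real^'v \<Rightarrow> real" where
  "evalp p w = (\<Sum>m\<in>Poly_Mapping.keys p. Poly_Mapping.lookup p m * eval_monom w m)"

lemma eval_monom_add: "eval_monom w (m + n) = eval_monom w m * eval_monom w n"
  by (simp add: eval_monom_def lookup_add power_add prod.distrib)

lemma evalp_single: "evalp (Poly_Mapping.single m c) w = c * eval_monom w m"
  by (simp add: evalp_def)

lemma evalp_add [simp]: "evalp (p + q) w = evalp p w + evalp q w"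
  unfolding evalp_def
  by (rule setsum_keys_plus_distrib) (simp_all add: distrib_right)

text \<open>Both sides are additive in each factor, so two single terms suffice, and there exponents
  add.\<close>

lemma evalp_mult [simp]: "evalp (p * q) w = evalp p w * evalp q w"
proof (induction p rule: rpoly_add_induct)
  case (single m c)
  show ?case
  proof (induction q rule: rpoly_add_induct)
    case (single n d)
    show ?case by (simp add: mult_single evalp_single eval_monom_add)
  qed (simp add: distrib_left)
qed (simp add: distrib_right)

lemma evalp_Const [simp]: "evalp (Const c) w = c"
  by (simp add: Const_def evalp_single eval_monom_def)

lemma evalp_0 [simp]: "evalp 0 w = 0" and evalp_1 [simp]: "evalp 1 w = 1"
  using evalp_Const[of 0 w] evalp_Const[of 1 w] by (simp_all add: Const_0 Const_1)

lemma evalp_Var [simp]: "evalp (Var v) w = w $ v"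
proof -
  have "(\<Prod>u\<in>UNIV. w $ u ^ Poly_Mapping.lookup (Poly_Mapping.single v (1::nat)) u) =
    (\<Prod>u\<in>UNIV. if u = v then w $ u else 1)"
    by (intro prod.cong) (auto simp: lookup_single when_def)
  then show ?thesis by (simp add: Var_def evalp_single eval_monom_def)
qed

lemma evalp_uminus [simp]: "evalp (- p) w = - evalp p w"
  using evalp_add[of p "- p" w] by simp

lemma evalp_diff [simp]: "evalp (p - q) w = evalp p w - evalp q w"
  using evalp_add[of p "- q" w] by simp

lemma evalp_sum [simp]: "evalp (\<Sum>i\<in>I. f i) w = (\<Sum>i\<in>I. evalp (f i) w)"
  by (induction I rule: infinite_finite_induct) simp_all

lemma evalp_prod [simp]: "evalp (\<Prod>i\<in>I. f i) w = (\<Prod>i\<in>I. evalp (f i) w)"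
  by (induction I rule: infinite_finite_induct) simp_all

lemma evalp_power [simp]: "evalp (p ^ n) w = evalp p w ^ n"
  by (induction n) simp_all

lemma continuous_on_evalp: "continuous_on S (evalp p)"
  unfolding evalp_def eval_monom_def by (intro continuous_intros)

section \<open>Sums of squares and the quadratic module of a ball\<close>

lemma SOS_0: "0 \<in> SOS"
  unfolding SOS_def by (auto intro: exI[of _ "[]"])

lemma SOS_add: "p \<in> SOS \<Longrightarrow> q \<in> SOS \<Longrightarrow> p + q \<in> SOS"
proof -
  assume "p \<in> SOS" "q \<in> SOS"
  then obtain ps qs where "p = (\<Sum>q\<leftarrow>ps. q\<^sup>2)" "q = (\<Sum>q\<leftarrow>qs. q\<^sup>2)"
    unfolding SOS_def by auto
  then have "p + q = (\<Sum>q\<leftarrow>ps @ qs. q\<^sup>2)" by simp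
  then show ?thesis unfolding SOS_def by blast
qed

lemma SOS_square: "p\<^sup>2 \<in> SOS"
  unfolding SOS_def by (auto intro: exI[of _ "[p]"])

lemma SOS_sum: "(\<And>i. i \<in> I \<Longrightarrow> f i \<in> SOS) \<Longrightarrow> (\<Sum>i\<in>I. f i) \<in> SOS"
  by (induction I rule: infinite_finite_induct) (auto intro: SOS_0 SOS_add)

lemma SOS_square_mult: "q \<in> SOS \<Longrightarrow> p\<^sup>2 * q \<in> SOS"
proof -
  assume "q \<in> SOS"
  then obtain qs where q: "q = (\<Sum>q\<leftarrow>qs. q\<^sup>2)" unfolding SOS_def by auto
  have "p\<^sup>2 * q = (\<Sum>q\<leftarrow>map ((*) p) qs. q\<^sup>2)"
    unfolding q by (induction qs) (simp_all add: distrib_left power_mult_distrib)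
  then show ?thesis unfolding SOS_def by blast
qed

lemma SOS_mult:
  assumes "p \<in> SOS" "q \<in> SOS" shows "p * q \<in> SOS"
proof -
  obtain ps where p: "p = (\<Sum>q\<leftarrow>ps. q\<^sup>2)" using assms unfolding SOS_def by auto
  show ?thesis unfolding p
    by (induction ps) (auto simp: distrib_right intro: SOS_0 SOS_add SOS_square_mult assms)
qed

lemma SOS_Const: "0 \<le> c \<Longrightarrow> Const c \<in> SOS"
  using SOS_square[of "Const (sqrt c)"] by (simp add: Const_power2[symmetric])

lemma SOS_1: "1 \<in> SOS"
  using SOS_Const[of 1] by (simp add: Const_1)

lemma evalp_SOS: "p \<in> SOS \<Longrightarrow> 0 \<le> evalp p w"
proof -
  assume "p \<in> SOS"
  then obtain ps where p: "p = (\<Sum>q\<leftarrow>ps. q\<^sup>2)" unfolding SOS_def by auto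
  show ?thesis unfolding p by (induction ps) auto
qed

text \<open>With the single generator \<open>N\<close> a quadratic module is already a preordering,
  because \<open>N\<^sup>2\<close> is a square.\<close>

definition QM1 :: "'v rpoly \<Rightarrow> 'v rpoly set" where
  "QM1 N = {s + t * N | s t. s \<in> SOS \<and> t \<in> SOS}"

lemma QM1_SOS: "p \<in> SOS \<Longrightarrow> p \<in> QM1 N"
proof -
  assume "p \<in> SOS"
  moreover have "p = p + 0 * N" by simp
  ultimately show ?thesis unfolding QM1_def using SOS_0 by blast
qed

lemma QM1_generator: "N \<in> QM1 N"
proof -
  have "N = 0 + Const 1 * N" by (simp add: Const_1)
  then show ?thesis unfolding QM1_def using SOS_0 SOS_Const[of 1] zero_le_one by blast
qed

lemma QM1_add: "p \<in> QM1 N \<Longrightarrow> q \<in> QM1 N \<Longrightarrow> p + q \<in> QM1 N"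
proof -
  assume "p \<in> QM1 N" "q \<in> QM1 N"
  then obtain s t s' t' where
    *: "p = s + t * N" "q = s' + t' * N" "s \<in> SOS" "t \<in> SOS" "s' \<in> SOS" "t' \<in> SOS"
    unfolding QM1_def by blast
  have "p + q = (s + s') + (t + t') * N" using * by (simp add: algebra_simps)
  then show ?thesis unfolding QM1_def using * SOS_add by blast
qed

lemma QM1_mult: "p \<in> QM1 N \<Longrightarrow> q \<in> QM1 N \<Longrightarrow> p * q \<in> QM1 N"
proof -
  assume "p \<in> QM1 N" "q \<in> QM1 N"
  then obtain s t s' t' where
    *: "p = s + t * N" "q = s' + t' * N" "s \<in> SOS" "t \<in> SOS" "s' \<in> SOS" "t' \<in> SOS"
    unfolding QM1_def by blast
  have "p * q = (s * s' + N\<^sup>2 * (t * t')) + (s * t' + t * s') * N"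
    using * by (simp add: algebra_simps power2_eq_square)
  moreover have "s * s' + N\<^sup>2 * (t * t') \<in> SOS" "s * t' + t * s' \<in> SOS"
    using * by (auto intro!: SOS_add SOS_mult SOS_square)
  ultimately show ?thesis unfolding QM1_def by blast
qed

lemma QM1_sum: "(\<And>i. i \<in> I \<Longrightarrow> f i \<in> QM1 N) \<Longrightarrow> (\<Sum>i\<in>I. f i) \<in> QM1 N"
  by (induction I rule: infinite_finite_induct) (auto intro: QM1_add QM1_SOS SOS_0)

lemma QM1_prod: "(\<And>i. i \<in> I \<Longrightarrow> f i \<in> QM1 N) \<Longrightarrow> (\<Prod>i\<in>I. f i) \<in> QM1 N"
proof (induction I rule: infinite_finite_induct)
  case (insert x F) then show ?case by (simp add: QM1_mult)
qed (use QM1_SOS[OF SOS_Const[of 1]] in \<open>simp_all add: Const_1\<close>)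

lemma QM1_power: "p \<in> QM1 N \<Longrightarrow> p ^ n \<in> QM1 N"
  using QM1_prod[of "{..<n}" "\<lambda>_. p"] by simp

section \<open>The ball of squared radius \<open>R\<close> and the faces of a box around it\<close>

definition ball_poly :: "real \<Rightarrow> ('v::finite) rpoly" where
  "ball_poly R = Const R - (\<Sum>v\<in>UNIV. (Var v)\<^sup>2)"

text \<open>With L = c + e v, the identity 2 c L = L^2 + (c^2 - R) + (sum of u^2 over u other than
  v) + \<open>ball_poly R\<close> exhibits L in the module. The two choices e = 1 and e = -1 give
  opposite faces of the box.\<close>

lemma QM1_ball_affine:
  fixes v :: "'v::finite"
  assumes c: "c > 0" "R \<le> c\<^sup>2" and e: "e\<^sup>2 = 1"
  shows "Const c + Const e * Var v \<in> QM1 (ball_poly R)"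
proof -
  let ?L = "Const c + Const e * Var v :: 'v rpoly"
  have e2: "Const e * Const e = (1 :: 'v rpoly)"
    using e by (simp add: Const_mult[symmetric] power2_eq_square Const_1)
  have split: "(\<Sum>u\<in>UNIV. (Var u)\<^sup>2) = (Var v)\<^sup>2 + (\<Sum>u\<in>UNIV - {v}. (Var u)\<^sup>2 :: 'v rpoly)"
    by (rule sum.remove) auto
  let ?K = "?L\<^sup>2 + Const (c\<^sup>2 - R) + (\<Sum>u\<in>UNIV - {v}. (Var u)\<^sup>2) + ball_poly R"
  have "?K = Const c * Const c + 2 * Const c * (Const e * Var v) + (Const e * Const e) * (Var v)\<^sup>2
     + Const c * Const c - (Var v)\<^sup>2"
    unfolding ball_poly_def split Const_diff Const_power2 by (simp add: algebra_simps power2_eq_square)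
  also have "\<dots> = 2 * Const c * ?L"
    unfolding e2 by (simp add: algebra_simps)
  finally have "Const (1 / (2 * c)) * ?K = Const (1 / (2 * c)) * 2 * Const c * ?L"
    by (simp only: mult.assoc)
  also have "\<dots> = Const (1 / (2 * c) * of_nat 2 * c) * ?L"
    unfolding Const_mult Const_of_nat by simp
  also have "1 / (2 * c) * of_nat 2 * c = 1" using c by simp
  finally have eq: "?L = Const (1 / (2 * c)) * ?K" by (simp add: Const_1)
  have "?K \<in> QM1 (ball_poly R)"
    using c by (intro QM1_add QM1_SOS SOS_square SOS_sum SOS_Const QM1_generator) auto
  moreover have "Const (1 / (2 * c)) \<in> QM1 (ball_poly R :: 'v rpoly)"
    using c by (intro QM1_SOS SOS_Const) auto
  ultimately show ?thesis unfolding eq[symmetric] by (subst eq) (rule QM1_mult)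
qed

section \<open>Bernstein expansion on a box\<close>

text \<open>The Bernstein basis, over a general ring so that the argument can itself be a
  polynomial.\<close>

definition bern :: "nat \<Rightarrow> nat \<Rightarrow> 'a::comm_ring_1 \<Rightarrow> 'a" where
  "bern n k y = of_nat (n choose k) * y ^ k * (1 - y) ^ (n - k)"

text \<open>This is the coefficient of index k when y^j is expanded in the Bernstein basis of degree
  n. It vanishes for k < j.\<close>

definition binom_ratio :: "nat \<Rightarrow> nat \<Rightarrow> nat \<Rightarrow> real" where
  "binom_ratio n k j = real (k choose j) / real (n choose j)"

text \<open>Multiply y^j by 1 = (y + (1 - y))^(n - j) and expand; the coefficients match because (n
  choose k) (k choose j) = (n choose j) (n - j choose k - j).\<close>

lemma power_eq_sum_bern:
  fixes y :: "'v rpoly"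
  assumes "j \<le> n"
  shows "y ^ j = (\<Sum>k\<le>n. Const (binom_ratio n k j) * bern n k y)"
proof -
  have coeff: "Const (binom_ratio n k j) * of_nat (n choose k) = (of_nat ((n - j) choose (k - j)) :: 'v rpoly)"
    if "j \<le> k" "k \<le> n" for k
  proof -
    have "real (n choose k) * real (k choose j) = real (n choose j) * real ((n - j) choose (k - j))"
      using choose_mult[OF that] by (simp only: of_nat_mult[symmetric])
    then have "binom_ratio n k j * real (n choose k) = real ((n - j) choose (k - j))"
      using assms by (simp add: binom_ratio_def field_simps)
    then show ?thesis by (simp add: Const_of_nat[symmetric] Const_mult[symmetric])
  qed
  have "y ^ j = y ^ j * (y + (1 - y)) ^ (n - j)" by simp
  also have "\<dots> = (\<Sum>m\<le>n - j. of_nat ((n - j) choose m) * y ^ (m + j) * (1 - y) ^ (n - j - m))"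
    unfolding binomial_ring sum_distrib_left
    by (intro sum.cong refl) (simp add: power_add mult_ac)
  also have "\<dots> = (\<Sum>k\<in>{j..n}. of_nat ((n - j) choose (k - j)) * y ^ k * (1 - y) ^ (n - k))"
    by (rule sum.reindex_bij_witness[where i = "\<lambda>k. k - j" and j = "\<lambda>m. m + j"])
       (use assms in \<open>auto simp: add.commute\<close>)
  also have "\<dots> = (\<Sum>k\<in>{j..n}. Const (binom_ratio n k j) * bern n k y)"
    unfolding bern_def by (intro sum.cong refl) (simp add: coeff[symmetric] mult_ac)
  \<comment> \<open>The added terms have k < j, where the ratio is zero.\<close>
  also have "\<dots> = (\<Sum>k\<le>n. Const (binom_ratio n k j) * bern n k y)"
    by (rule sum.mono_neutral_left) (auto simp: binom_ratio_def Const_0 not_le binomial_eq_0)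
  finally show ?thesis .
qed

lemma binom_ratio_bounds: "k \<le> n \<Longrightarrow> 0 \<le> binom_ratio n k j \<and> binom_ratio n k j \<le> 1"
  using binomial_right_mono[of k n j] by (simp add: binom_ratio_def divide_le_eq)

text \<open>Apply (j + 1) (m choose j + 1) = (m - j) (m choose j) to numerator and denominator. Thus
  the ratio is a product of factors (k - i) / (n - i).\<close>

lemma binom_ratio_Suc:
  assumes "j \<le> k" "k \<le> n" "j < n"
  shows "binom_ratio n k (Suc j) = binom_ratio n k j * ((real k - real j) / (real n - real j))"
proof -
  have s: "real (Suc j) * real (m choose Suc j) = (real m - real j) * real (m choose j)" if "j \<le> m" for m
    using binomial_absorb_comp[of m j] binomial_absorption[of j m] that
    by (metis Suc_times_binomial_eq binomial_absorption diff_Suc_Suc mult.commute of_nat_diff of_nat_mult)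
  have "binom_ratio n k (Suc j) =
      (real (Suc j) * real (k choose Suc j)) / (real (Suc j) * real (n choose Suc j))"
    by (simp add: binom_ratio_def)
  then show ?thesis using assms by (simp only: s) (simp add: binom_ratio_def mult.commute)
qed

text \<open>Each factor (k - i) / (n - i) is within i / (n - i) of k / n, and these errors add up
  along the product. The bound does not depend on k, so it is uniform over the grid.\<close>

lemma binom_ratio_approx:
  assumes "k \<le> n" "j < n"
  shows "\<bar>binom_ratio n k j - (real k / real n) ^ j\<bar> \<le> (real j)\<^sup>2 / (real n - real j)"
  using assms(2)
proof (induction j)
  case 0
  then show ?case by (simp add: binom_ratio_def)
next
  case (Suc j)
  define q where "q = real k / real n"
  define r where "r = binom_ratio n k j"
  have q: "0 \<le> q" "q \<le> 1" using assms(1) Suc.prems by (auto simp: q_def divide_le_eq)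
  have r: "0 \<le> r" "r \<le> 1" using binom_ratio_bounds[OF assms(1)] by (auto simp: r_def)
  have IH: "\<bar>r - q ^ j\<bar> \<le> (real j)\<^sup>2 / (real n - real j)" using Suc by (simp add: q_def r_def)
  have nj: "real n - real j \<ge> 1" using Suc.prems by linarith
  have IH': "\<bar>q * (r - q ^ j)\<bar> \<le> (real j)\<^sup>2 / (real n - real j)"
    using mult_mono[of "\<bar>q\<bar>" 1 "\<bar>r - q ^ j\<bar>"] q IH by (simp add: abs_mult)
  have "\<bar>binom_ratio n k (Suc j) - q ^ Suc j\<bar> \<le> ((real j)\<^sup>2 + real j) / (real n - real j)"
  proof (cases "j \<le> k")
    case True
    define s where "s = (real k - real j) / (real n - real j)"
    have "s - q = - (real j / (real n - real j)) * ((real n - real k) / real n)"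
      using nj Suc.prems unfolding s_def q_def by (simp add: field_simps)
    moreover have "0 \<le> (real n - real k) / real n" "(real n - real k) / real n \<le> 1"
      using assms(1) Suc.prems by (auto simp: divide_le_eq)
    moreover have "0 \<le> real j / (real n - real j)" using nj by simp
    ultimately have sq: "\<bar>s - q\<bar> \<le> real j / (real n - real j)"
      by (simp only: abs_mult abs_minus abs_of_nonneg) (rule mult_left_le, auto)
    have "\<bar>r * (s - q)\<bar> \<le> real j / (real n - real j)"
      using mult_mono[of "\<bar>r\<bar>" 1 "\<bar>s - q\<bar>"] r sq by (simp add: abs_mult)
    \<comment> \<open>Splits off the error of the new factor from the error inherited from j; both
      are multiplied by numbers in [0, 1].\<close>
    moreover have "binom_ratio n k (Suc j) - q ^ Suc j = r * (s - q) + q * (r - q ^ j)"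
      using binom_ratio_Suc[OF True assms(1)] Suc.prems by (simp add: r_def s_def algebra_simps)
    ultimately have "\<bar>binom_ratio n k (Suc j) - q ^ Suc j\<bar> \<le>
        real j / (real n - real j) + (real j)\<^sup>2 / (real n - real j)"
      using IH' by linarith
    then show ?thesis by (simp add: add_divide_distrib)
  next
    case False
    \<comment> \<open>Past k both ratios vanish, so the new error is just q times the old
      one.\<close>
    then have "r = 0" "binom_ratio n k (Suc j) = 0" by (auto simp: r_def binom_ratio_def)
    then have "\<bar>binom_ratio n k (Suc j) - q ^ Suc j\<bar> \<le> (real j)\<^sup>2 / (real n - real j)"
      using IH' by simp
    also have "\<dots> \<le> ((real j)\<^sup>2 + real j) / (real n - real j)"
      using nj by (intro divide_right_mono) auto
    finally show ?thesis .
  qed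
  also have "\<dots> \<le> (real (Suc j))\<^sup>2 / (real n - real (Suc j))"
  proof (rule frac_le)
    show "0 < real n - real (Suc j)" using Suc.prems by linarith
  qed (auto simp: power2_eq_square algebra_simps)
  finally show ?case by (simp add: q_def)
qed

section \<open>Coordinates rescaled from [-c, c] to [0, 1], and Bernstein coefficients on the
  box\<close>

definition unit_var :: "real \<Rightarrow> 'v \<Rightarrow> 'v rpoly" where
  "unit_var c v = Const (1 / 2) + Const (1 / (2 * c)) * Var v"

definition grid_point :: "real \<Rightarrow> nat \<Rightarrow> ('v \<Rightarrow> nat) \<Rightarrow> real^'v" where
  "grid_point c n \<kappa> = (\<chi> v. 2 * c * (real (\<kappa> v) / real n) - c)"

abbreviation grid :: "nat \<Rightarrow> ('v \<Rightarrow> nat) set" where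
  "grid n \<equiv> PiE UNIV (\<lambda>_. {..n})"

lemma evalp_unit_var_grid_point:
  "c > 0 \<Longrightarrow> evalp (unit_var c v) (grid_point c n \<kappa>) = real (\<kappa> v) / real n"
  by (simp add: unit_var_def grid_point_def field_simps)

text \<open>Introduced for its induction rule: once it is known to contain every polynomial, it
  remains to treat one monomial in the rescaled variables, and sums.\<close>

inductive_set unit_monoms :: "real \<Rightarrow> ('v::finite) rpoly set" for c where
  monom: "Const a * (\<Prod>v\<in>UNIV. unit_var c v ^ \<alpha> v) \<in> unit_monoms c"
| add: "p \<in> unit_monoms c \<Longrightarrow> q \<in> unit_monoms c \<Longrightarrow> p + q \<in> unit_monoms c"

lemma unit_monoms_mult:
  assumes "p \<in> unit_monoms c" "q \<in> unit_monoms c"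
  shows "p * q \<in> unit_monoms c"
  using assms(1)
proof induction
  case (monom a \<alpha>)
  show ?case using assms(2)
  proof induction
    case (monom b \<beta>)
    have "Const a * (\<Prod>v\<in>UNIV. unit_var c v ^ \<alpha> v) * (Const b * (\<Prod>v\<in>UNIV. unit_var c v ^ \<beta> v))
      = Const (a * b) * (\<Prod>v\<in>UNIV. unit_var c v ^ (\<alpha> v + \<beta> v))"
      by (simp add: Const_mult power_add prod.distrib mult_ac)
    then show ?case by (simp only:) (rule unit_monoms.monom)
  qed (simp add: distrib_left unit_monoms.add)
qed (simp add: distrib_right unit_monoms.add)

lemma unit_monoms_UNIV:
  fixes p :: "('v::finite) rpoly"
  assumes "c > 0"
  shows "p \<in> unit_monoms c"
proof (induction p rule: rpoly_induct)
  case (Const a)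
  show ?case using unit_monoms.monom[of a c "\<lambda>_. 0"] by simp
next
  case (Var v)
  have "(\<Prod>u\<in>UNIV. unit_var c u ^ (if u = v then 1 else 0)) = (\<Prod>u\<in>UNIV. if u = v then unit_var c u else 1)"
    by (intro prod.cong) auto
  then have p: "(\<Prod>u\<in>UNIV. unit_var c u ^ (if u = v then 1 else 0)) = unit_var c v"
    by simp
  have "Var v = Const (2 * c) * unit_var c v + Const (- c)"
    unfolding unit_var_def distrib_left mult.assoc[symmetric] Const_mult[symmetric]
    using assms by (simp add: Const_1 add.assoc Const_add[symmetric] Const_0 add.commute[of _ "Const (-c)"]
        add.left_commute)
  also have "\<dots> = Const (2 * c) * (\<Prod>u\<in>UNIV. unit_var c u ^ (if u = v then 1 else 0))
      + Const (- c) * (\<Prod>u\<in>UNIV. unit_var c u ^ 0)"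
    unfolding p by simp
  finally show ?case by (simp only:) (intro unit_monoms.intros)
qed (auto intro: unit_monoms.add unit_monoms_mult)

text \<open>For a monomial the coefficients are products of \<open>binom_ratio\<close>, which
  approximate the corresponding products of powers of \<open>\<kappa> v / n\<close>. The claim
  covers all large n so that two summands can be expanded in a common degree.\<close>

lemma bernstein_coefficients:
  fixes p :: "('v::finite) rpoly"
  assumes c: "c > 0" and \<epsilon>: "\<epsilon> > 0"
  shows "\<exists>n0. \<forall>n\<ge>n0. \<exists>b.
    p = (\<Sum>\<kappa>\<in>grid n. Const (b \<kappa>) * (\<Prod>v\<in>UNIV. bern n (\<kappa> v) (unit_var c v))) \<and>
    (\<forall>\<kappa>\<in>grid n. \<bar>b \<kappa> - evalp p (grid_point c n \<kappa>)\<bar> \<le> \<epsilon>)"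
  using unit_monoms_UNIV[OF c, of p] \<epsilon>
proof (induction arbitrary: \<epsilon>)
  case (monom a \<alpha>)
  define M where "M = (\<Sum>v\<in>UNIV. \<alpha> v)"
  have M: "\<alpha> v \<le> M" for v unfolding M_def by (rule member_le_sum) auto
  \<comment> \<open>Chosen so that every coefficient is off by at most K / (n - M).\<close>
  define K where "K = \<bar>a\<bar> * (real CARD('v) * (real M)\<^sup>2)"
  have "K \<ge> 0" by (simp add: K_def)
  show ?case
  \<comment> \<open>The threshold makes n exceed every exponent and makes n - M at least
    \<open>K / \<epsilon>\<close>.\<close>
  proof (intro exI[of _ "M + 1 + nat \<lceil>K / \<epsilon>\<rceil>"] allI impI)
    fix n assume n: "M + 1 + nat \<lceil>K / \<epsilon>\<rceil> \<le> n"
    then have Mn: "M < n" by simp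
    have "K / \<epsilon> \<le> real n - real M" using n \<open>K \<ge> 0\<close> monom by linarith
    then have Ke: "K / (real n - real M) \<le> \<epsilon>" using Mn monom by (simp add: field_simps)
    define b where "b \<kappa> = a * (\<Prod>v\<in>UNIV. binom_ratio n (\<kappa> v) (\<alpha> v))" for \<kappa> :: "'v \<Rightarrow> nat"
    have "(\<Prod>v\<in>UNIV. unit_var c v ^ \<alpha> v) =
      (\<Prod>v\<in>UNIV. \<Sum>k\<le>n. Const (binom_ratio n k (\<alpha> v)) * bern n k (unit_var c v))"
      using M Mn by (intro prod.cong refl power_eq_sum_bern) (meson le_trans less_imp_le)
    also have "\<dots> = (\<Sum>\<kappa>\<in>grid n. \<Prod>v\<in>UNIV. Const (binom_ratio n (\<kappa> v) (\<alpha> v)) * bern n (\<kappa> v) (unit_var c v))"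
      by (rule prod_sum_PiE) auto
    finally have eq: "Const a * (\<Prod>v\<in>UNIV. unit_var c v ^ \<alpha> v) =
      (\<Sum>\<kappa>\<in>grid n. Const (b \<kappa>) * (\<Prod>v\<in>UNIV. bern n (\<kappa> v) (unit_var c v)))"
      by (simp add: b_def prod.distrib sum_distrib_left Const_mult Const_prod mult.assoc)
    have "\<bar>b \<kappa> - evalp (Const a * (\<Prod>v\<in>UNIV. unit_var c v ^ \<alpha> v)) (grid_point c n \<kappa>)\<bar> \<le> \<epsilon>"
      if \<kappa>: "\<kappa> \<in> grid n" for \<kappa>
    proof -
      have \<kappa>n: "\<kappa> v \<le> n" for v using \<kappa> by (auto simp: PiE_iff)
      \<comment> \<open>All factors have absolute value at most 1, so the error of the product is at
        most the sum of the errors of the factors.\<close>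
      have "\<bar>(\<Prod>v\<in>UNIV. binom_ratio n (\<kappa> v) (\<alpha> v)) - (\<Prod>v\<in>UNIV. (real (\<kappa> v) / real n) ^ \<alpha> v)\<bar> \<le>
        (\<Sum>v\<in>UNIV. \<bar>binom_ratio n (\<kappa> v) (\<alpha> v) - (real (\<kappa> v) / real n) ^ \<alpha> v\<bar>)"
        unfolding real_norm_def[symmetric]
      proof (rule norm_prod_diff)
        fix v
        show "norm (binom_ratio n (\<kappa> v) (\<alpha> v)) \<le> 1" using binom_ratio_bounds[OF \<kappa>n] by simp
        show "norm ((real (\<kappa> v) / real n) ^ \<alpha> v) \<le> 1"
          using \<kappa>n[of v] Mn by (simp add: power_le_one divide_le_eq)
      qed
      also have "\<dots> \<le> (\<Sum>v\<in>(UNIV::'v set). (real M)\<^sup>2 / (real n - real M))"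
      proof (rule sum_mono)
        fix v
        have "\<alpha> v < n" using M[of v] Mn by linarith
        from binom_ratio_approx[OF \<kappa>n this, of v]
        have "\<bar>binom_ratio n (\<kappa> v) (\<alpha> v) - (real (\<kappa> v) / real n) ^ \<alpha> v\<bar>
          \<le> (real (\<alpha> v))\<^sup>2 / (real n - real (\<alpha> v))" .
        also have "\<dots> \<le> (real M)\<^sup>2 / (real n - real M)"
          using M[of v] Mn by (intro frac_le power_mono) auto
        finally show "\<bar>binom_ratio n (\<kappa> v) (\<alpha> v) - (real (\<kappa> v) / real n) ^ \<alpha> v\<bar> \<le> (real M)\<^sup>2 / (real n - real M)" .
      qed
      finally have "\<bar>a\<bar> * \<bar>(\<Prod>v\<in>UNIV. binom_ratio n (\<kappa> v) (\<alpha> v)) - (\<Prod>v\<in>UNIV. (real (\<kappa> v) / real n) ^ \<alpha> v)\<bar>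
        \<le> \<bar>a\<bar> * (real CARD('v) * ((real M)\<^sup>2 / (real n - real M)))"
        by (intro mult_left_mono) auto
      also have "\<dots> = K / (real n - real M)" by (simp add: K_def)
      finally show ?thesis using Ke
        by (simp add: b_def evalp_unit_var_grid_point[OF c] abs_mult[symmetric] right_diff_distrib)
    qed
    with eq show "\<exists>b. Const a * (\<Prod>v\<in>UNIV. unit_var c v ^ \<alpha> v) =
        (\<Sum>\<kappa>\<in>grid n. Const (b \<kappa>) * (\<Prod>v\<in>UNIV. bern n (\<kappa> v) (unit_var c v))) \<and>
      (\<forall>\<kappa>\<in>grid n. \<bar>b \<kappa> - evalp (Const a * (\<Prod>v\<in>UNIV. unit_var c v ^ \<alpha> v)) (grid_point c n \<kappa>)\<bar> \<le> \<epsilon>)"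
      by blast
  qed
next
  case (add p q)
  have "\<epsilon> / 2 > 0" using add.prems by simp
  from add.IH(1)[OF this] add.IH(2)[OF this] obtain n1 n2 where
    n1: "\<forall>n\<ge>n1. \<exists>b. p = (\<Sum>\<kappa>\<in>grid n. Const (b \<kappa>) * (\<Prod>v\<in>UNIV. bern n (\<kappa> v) (unit_var c v))) \<and>
      (\<forall>\<kappa>\<in>grid n. \<bar>b \<kappa> - evalp p (grid_point c n \<kappa>)\<bar> \<le> \<epsilon> / 2)" and
    n2: "\<forall>n\<ge>n2. \<exists>b. q = (\<Sum>\<kappa>\<in>grid n. Const (b \<kappa>) * (\<Prod>v\<in>UNIV. bern n (\<kappa> v) (unit_var c v))) \<and>
      (\<forall>\<kappa>\<in>grid n. \<bar>b \<kappa> - evalp q (grid_point c n \<kappa>)\<bar> \<le> \<epsilon> / 2)"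
    by blast
  show ?case
  proof (intro exI[of _ "max n1 n2"] allI impI)
    fix n assume "max n1 n2 \<le> n"
    then have "n1 \<le> n" "n2 \<le> n" by auto
    from n1[rule_format, OF this(1)] obtain b where
      b: "p = (\<Sum>\<kappa>\<in>grid n. Const (b \<kappa>) * (\<Prod>v\<in>UNIV. bern n (\<kappa> v) (unit_var c v)))"
        "\<forall>\<kappa>\<in>grid n. \<bar>b \<kappa> - evalp p (grid_point c n \<kappa>)\<bar> \<le> \<epsilon> / 2" by blast
    from n2[rule_format, OF \<open>n2 \<le> n\<close>] obtain b' where
      b': "q = (\<Sum>\<kappa>\<in>grid n. Const (b' \<kappa>) * (\<Prod>v\<in>UNIV. bern n (\<kappa> v) (unit_var c v)))"
        "\<forall>\<kappa>\<in>grid n. \<bar>b' \<kappa> - evalp q (grid_point c n \<kappa>)\<bar> \<le> \<epsilon> / 2"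
      by blast
    have "p + q = (\<Sum>\<kappa>\<in>grid n. Const (b \<kappa> + b' \<kappa>) * (\<Prod>v\<in>UNIV. bern n (\<kappa> v) (unit_var c v)))"
      by (subst b(1), subst b'(1)) (simp add: Const_add distrib_right sum.distrib)
    moreover have "\<bar>b \<kappa> + b' \<kappa> - evalp (p + q) (grid_point c n \<kappa>)\<bar> \<le> \<epsilon>" if "\<kappa> \<in> grid n" for \<kappa>
    proof -
      have "\<bar>b \<kappa> - evalp p (grid_point c n \<kappa>)\<bar> \<le> \<epsilon> / 2" "\<bar>b' \<kappa> - evalp q (grid_point c n \<kappa>)\<bar> \<le> \<epsilon> / 2"
        using b(2) b'(2) that by blast+
      then show ?thesis unfolding evalp_add by linarith
    qed
    ultimately show "\<exists>b. p + q = (\<Sum>\<kappa>\<in>grid n. Const (b \<kappa>) * (\<Prod>v\<in>UNIV. bern n (\<kappa> v) (unit_var c v))) \<and>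
      (\<forall>\<kappa>\<in>grid n. \<bar>b \<kappa> - evalp (p + q) (grid_point c n \<kappa>)\<bar> \<le> \<epsilon>)"
      by (intro exI[of _ "\<lambda>\<kappa>. b \<kappa> + b' \<kappa>"]) blast
  qed
qed

lemma unit_var_QM1:
  fixes v :: "'v::finite"
  assumes c: "c > 0" "R \<le> c\<^sup>2"
  shows "unit_var c v \<in> QM1 (ball_poly R)" "1 - unit_var c v \<in> QM1 (ball_poly R)"
proof -
  have h: "Const (1 / (2 * c)) \<in> QM1 (ball_poly R :: 'v rpoly)"
    using c by (intro QM1_SOS SOS_Const) auto
  have eq: "unit_var c v = Const (1 / (2 * c)) * (Const c + Const 1 * Var v)"
    using c by (simp add: unit_var_def distrib_left Const_mult[symmetric] mult.assoc[symmetric])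
  show "unit_var c v \<in> QM1 (ball_poly R)"
    unfolding eq using c by (intro QM1_mult h QM1_ball_affine) auto
  have "1 = (Const (1/2) + Const (1/2) :: 'v rpoly)"
    by (simp add: Const_add[symmetric] Const_1)
  moreover have "Const (1 / (2 * c) * -1) = (- Const (1 / (2 * c)) :: 'v rpoly)"
    by (simp add: Const_def single_uminus)
  ultimately have eq: "1 - unit_var c v = Const (1 / (2 * c)) * (Const c + Const (- 1) * Var v)"
    unfolding distrib_left mult.assoc[symmetric] Const_mult[symmetric]
    using c by (simp add: unit_var_def)
  show "1 - unit_var c v \<in> QM1 (ball_poly R)"
    unfolding eq using c by (intro QM1_mult h QM1_ball_affine) auto
qed

text \<open>Expand with an error of at most the minimum of p on the box. Then all Bernstein
  coefficients are nonnegative, and the basis polynomials are products of elements of the module,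
  which is closed under products.\<close>

theorem positive_on_box_in_QM1:
  fixes p :: "('v::finite) rpoly"
  assumes c: "c > 0" "R \<le> c\<^sup>2"
    and pos: "\<And>w. (\<forall>v. \<bar>w $ v\<bar> \<le> c) \<Longrightarrow> evalp p w > 0"
  shows "p \<in> QM1 (ball_poly R)"
proof -
  let ?C = "cbox (\<chi> v. - c) (\<chi> v. c) :: (real^'v) set"
  have C: "w \<in> ?C \<longleftrightarrow> (\<forall>v. \<bar>w $ v\<bar> \<le> c)" for w
    by (simp add: mem_box_cart abs_le_iff) (metis minus_le_iff)
  have "0 \<in> ?C" unfolding C using c by simp
  then obtain w0 where w0: "w0 \<in> ?C" "\<And>w. w \<in> ?C \<Longrightarrow> evalp p w0 \<le> evalp p w"
    using continuous_attains_inf[OF compact_cbox _ continuous_on_evalp] by (metis empty_iff)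
  have \<eta>: "evalp p w0 > 0" using pos w0(1) C by blast
  from bernstein_coefficients[OF c(1) this, of p] obtain n0 where
    n0: "\<forall>n\<ge>n0. \<exists>b. p = (\<Sum>\<kappa>\<in>grid n. Const (b \<kappa>) * (\<Prod>v\<in>UNIV. bern n (\<kappa> v) (unit_var c v))) \<and>
      (\<forall>\<kappa>\<in>grid n. \<bar>b \<kappa> - evalp p (grid_point c n \<kappa>)\<bar> \<le> evalp p w0)" by blast
  \<comment> \<open>The successor keeps the denominator of the grid points nonzero.\<close>
  define n where "n = Suc n0"
  have "n0 \<le> n" by (simp add: n_def)
  obtain b where b: "p = (\<Sum>\<kappa>\<in>grid n. Const (b \<kappa>) * (\<Prod>v\<in>UNIV. bern n (\<kappa> v) (unit_var c v)))"
      "\<And>\<kappa>. \<kappa> \<in> grid n \<Longrightarrow> \<bar>b \<kappa> - evalp p (grid_point c n \<kappa>)\<bar> \<le> evalp p w0"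
    using n0[rule_format, OF \<open>n0 \<le> n\<close>] by blast
  have "b \<kappa> \<ge> 0" if \<kappa>: "\<kappa> \<in> grid n" for \<kappa>
  proof -
    have "grid_point c n \<kappa> \<in> ?C"
    proof (unfold C, rule allI)
      fix v
      have "real (\<kappa> v) \<le> real n" using \<kappa> by (auto simp: PiE_iff)
      then have "real (\<kappa> v) / real n \<le> 1" "0 \<le> real (\<kappa> v) / real n"
        by (auto simp: n_def divide_le_eq)
      then have "c * (real (\<kappa> v) / real n) \<le> c" "0 \<le> c * (real (\<kappa> v) / real n)"
        using c by (auto intro: mult_left_le simp del: times_divide_eq_right)
      then show "\<bar>grid_point c n \<kappa> $ v\<bar> \<le> c"
        unfolding grid_point_def vec_lambda_beta mult.assoc abs_le_iff by linarith
    qed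
    then show ?thesis using w0(2)[of "grid_point c n \<kappa>"] b(2)[OF \<kappa>] by linarith
  qed
  moreover have "bern n k (unit_var c v) \<in> QM1 (ball_poly R)" for k and v :: 'v
    unfolding bern_def Const_of_nat[symmetric]
    by (intro QM1_mult QM1_power unit_var_QM1 c QM1_SOS[OF SOS_Const]) simp
  ultimately show ?thesis
    by (subst b(1)) (intro QM1_sum QM1_mult QM1_prod QM1_SOS[OF SOS_Const], auto)
qed

section \<open>Putinar's Positivstellensatz\<close>

text \<open>The quadratic module without degree bounds; for the generators \<open>gen a A B\<close>
  it is the union of the truncations \<open>QM t a A B\<close>.\<close>

definition QMod :: "('i::finite \<Rightarrow> 'v rpoly) \<Rightarrow> 'v rpoly set" where
  "QMod g = {s0 + (\<Sum>i\<in>UNIV. s i * g i) | s0 s. s0 \<in> SOS \<and> (\<forall>i. s i \<in> SOS)}"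

lemma QMod_I:
  "s0 \<in> SOS \<Longrightarrow> (\<And>i. s i \<in> SOS) \<Longrightarrow> s0 + (\<Sum>i\<in>UNIV. s i * g i) \<in> QMod g"
  unfolding QMod_def by blast

lemma QMod_E:
  assumes "p \<in> QMod g"
  obtains s0 s where "p = s0 + (\<Sum>i\<in>UNIV. s i * g i)" "s0 \<in> SOS" "\<forall>i. s i \<in> SOS"
  using assms unfolding QMod_def by blast

lemma QMod_SOS: "p \<in> SOS \<Longrightarrow> p \<in> QMod g"
  using QMod_I[of p "\<lambda>_. 0" g] SOS_0 by simp

lemma QMod_add:
  assumes "p \<in> QMod g" "q \<in> QMod g"
  shows "p + q \<in> QMod g"
proof -
  obtain s0 s where s: "p = s0 + (\<Sum>i\<in>UNIV. s i * g i)" "s0 \<in> SOS" "\<forall>i. s i \<in> SOS"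
    using assms(1) by (rule QMod_E)
  obtain t0 t where t: "q = t0 + (\<Sum>i\<in>UNIV. t i * g i)" "t0 \<in> SOS" "\<forall>i. t i \<in> SOS"
    using assms(2) by (rule QMod_E)
  have "p + q = (s0 + t0) + (\<Sum>i\<in>UNIV. (s i + t i) * g i)"
    using s(1) t(1) by (simp add: distrib_right sum.distrib)
  then show ?thesis using s(2-) t(2-) by (simp only:) (intro QMod_I SOS_add; blast)
qed

lemma QMod_SOS_mult:
  assumes "s \<in> SOS" "p \<in> QMod g"
  shows "s * p \<in> QMod g"
proof -
  obtain t0 t where
    *: "p = t0 + (\<Sum>i\<in>UNIV. t i * g i)" "t0 \<in> SOS" "\<forall>i. t i \<in> SOS"
    using assms(2) by (rule QMod_E)
  have "s * p = s * t0 + (\<Sum>i\<in>UNIV. (s * t i) * g i)"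
    using *(1) by (simp add: distrib_left sum_distrib_left mult.assoc)
  then show ?thesis using *(2-) assms(1) by (simp only:) (intro QMod_I SOS_mult; blast)
qed

lemma QMod_generator:
  fixes g :: "'i::finite \<Rightarrow> 'v rpoly"
  shows "g i \<in> QMod g"
proof -
  have "(\<Sum>j\<in>UNIV. (if j = i then 1 else 0) * g j) = (\<Sum>j\<in>UNIV. if j = i then g j else 0)"
    by (intro sum.cong) auto
  moreover have "(if j = i then 1 else 0 :: 'v rpoly) \<in> SOS" for j
    by (simp add: SOS_0 SOS_1)
  ultimately show ?thesis
    using QMod_I[of 0 "\<lambda>j. if j = i then 1 else 0" g] SOS_0 by simp
qed

lemma QMod_sum: "(\<And>i. i \<in> I \<Longrightarrow> f i \<in> QMod g) \<Longrightarrow> (\<Sum>i\<in>I. f i) \<in> QMod g"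
  by (induction I rule: infinite_finite_induct) (auto intro: QMod_add QMod_SOS SOS_0)

lemma QM1_subset_QMod: "N \<in> QMod g \<Longrightarrow> QM1 N \<subseteq> QMod g"
  unfolding QM1_def by (auto intro: QMod_add QMod_SOS QMod_SOS_mult)

lemma evalp_QMod:
  assumes "p \<in> QMod g" "\<And>i. 0 \<le> evalp (g i) w"
  shows "0 \<le> evalp p w"
proof -
  obtain s0 s where s: "p = s0 + (\<Sum>i\<in>UNIV. s i * g i)" "s0 \<in> SOS" "\<forall>i. s i \<in> SOS"
    using assms(1) by (rule QMod_E)
  show ?thesis unfolding s(1) evalp_add evalp_sum evalp_mult
    by (intro add_nonneg_nonneg sum_nonneg mult_nonneg_nonneg evalp_SOS[OF s(2)]
        evalp_SOS[OF s(3)[rule_format]] assms(2))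
qed

text \<open>For t <= 0 the square is at least 1, so the product is at most t. For 0 < t <= 1,
  Bernoulli gives m t <= (1 + t)^m, hence m t (1 - t)^m <= (1 - t^2)^m <= 1.\<close>

lemma penalty_bound:
  fixes t :: real
  assumes "t \<le> 1" "m > 0"
  shows "t * ((1 - t) ^ m)\<^sup>2 \<le> 1 / real m - max 0 (- t)"
proof (cases "t \<le> 0")
  case True
  have "1 \<le> ((1 - t) ^ m)\<^sup>2" using True by (simp add: one_le_power)
  then have "t * ((1 - t) ^ m)\<^sup>2 \<le> t * 1" using True by (rule mult_left_mono_neg)
  moreover have "0 \<le> 1 / real m" by simp
  moreover have "max 0 (- t) = - t" using True by simp
  ultimately show ?thesis by linarith
next
  case False
  have pow1: "0 \<le> (1 - t) ^ m" "(1 - t) ^ m \<le> 1" using False assms by (auto intro: power_le_one)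
  have "real m * t * (1 - t) ^ m \<le> (1 + real m * t) * (1 - t) ^ m"
    using pow1 by (intro mult_right_mono) auto
  also have "\<dots> \<le> (1 + t) ^ m * (1 - t) ^ m"
    using Bernoulli_inequality[of t m] False pow1 by (intro mult_right_mono) (auto simp: mult.commute)
  also have "\<dots> = (1 - t\<^sup>2) ^ m" by (simp add: power_mult_distrib[symmetric] power2_eq_square algebra_simps)
  also have "\<dots> \<le> 1" using False assms by (intro power_le_one) (auto simp: power_le_one)
  finally have 1: "t * (1 - t) ^ m \<le> 1 / real m" using assms by (simp add: field_simps)
  have "t * ((1 - t) ^ m)\<^sup>2 \<le> t * (1 - t) ^ m"
    unfolding power2_eq_square using pow1 False by (intro mult_left_mono mult_left_le) auto
  moreover have "max 0 (- t) = 0" using False by simp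
  ultimately show ?thesis using 1 by linarith
qed

text \<open>Following Schweighofer: subtracting \<open>\<lambda> \<Sum>\<^sub>i g\<^sub>i (1 - g\<^sub>i)\<^sup>2\<^sup>m\<close> (with \<open>g\<^sub>i\<close> scaled to be at
  most 1 on the box) costs almost nothing where all \<open>g\<^sub>i\<close> are nonnegative and makes the result
  positive elsewhere on the box.\<close>

theorem putinar:
  fixes g :: "'i::finite \<Rightarrow> ('v::finite) rpoly" and f :: "'v rpoly"
  assumes ball: "ball_poly R \<in> QMod g"
    and pos: "\<And>w. (\<forall>i. 0 \<le> evalp (g i) w) \<Longrightarrow> 0 < evalp f w"
  shows "f \<in> QMod g"
proof -
  \<comment> \<open>As c >= 1, this gives R <= c <= c^2, so the box contains the ball.\<close>
  define c where "c = \<bar>R\<bar> + 1"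
  have c: "c > 0" "R \<le> c\<^sup>2" 
  proof -
    have "R \<le> 1 * c" by (simp add: c_def)
    also have "\<dots> \<le> c * c" by (intro mult_right_mono) (auto simp: c_def)
    finally show "R \<le> c\<^sup>2" by (simp add: power2_eq_square)
  qed (simp add: c_def)
  define C where "C = (cbox (\<chi> v. - c) (\<chi> v. c) :: (real^'v) set)"
  have C: "w \<in> C \<longleftrightarrow> (\<forall>v. \<bar>w $ v\<bar> \<le> c)" for w
    by (simp add: C_def mem_box_cart abs_le_iff) (metis minus_le_iff)
  have cC: "compact C" by (simp add: C_def compact_cbox)
  have bdd: "\<exists>B. \<forall>w\<in>C. \<bar>evalp p w\<bar> \<le> B" for p
    using compact_imp_bounded[OF compact_continuous_image[OF continuous_on_evalp cC, of p]]
    by (auto simp: bounded_iff)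
  have "\<forall>i. \<exists>B. \<forall>w\<in>C. \<bar>evalp (g i) w\<bar> \<le> B" using bdd by blast
  then obtain Bg where "\<forall>i. \<forall>w\<in>C. \<bar>evalp (g i) w\<bar> \<le> Bg i" by (rule choice[THEN exE])
  then have Bg: "\<bar>evalp (g i) w\<bar> \<le> Bg i" if "w \<in> C" for i w using that by blast
  \<comment> \<open>A common upper bound for all generators on the box, positive so that one can
    divide by it.\<close>
  define G where "G = 1 + (\<Sum>i\<in>UNIV. \<bar>Bg i\<bar>)"
  have G: "G > 0" unfolding G_def by (simp add: add_pos_nonneg sum_nonneg)
  have gG: "evalp (g i) w \<le> G" if "w \<in> C" for i w
  proof -
    have "\<bar>Bg i\<bar> \<le> (\<Sum>i\<in>UNIV. \<bar>Bg i\<bar>)" by (rule member_le_sum) auto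
    then show ?thesis using Bg[OF that, of i] unfolding G_def by linarith
  qed
  \<comment> \<open>The total violation of the constraints, built from the term subtracted in
    \<open>penalty_bound\<close>.\<close>
  define h where "h w = (\<Sum>i\<in>UNIV. max 0 (- (evalp (g i) w / G)))" for w
  have h0: "h w \<ge> 0" for w unfolding h_def by (intro sum_nonneg) auto
  have hpos: "h w > 0" if "evalp f w \<le> 0" for w
  proof -
    have "\<not> (\<forall>i. 0 \<le> evalp (g i) w)" using pos[of w] that by auto
    then obtain i where "evalp (g i) w < 0" by (auto simp: not_le)
    then have "0 < max 0 (- (evalp (g i) w / G))" using G by (simp add: less_max_iff_disj divide_neg_pos)
    then show ?thesis unfolding h_def by (intro sum_pos2[of _ i]) auto
  qed
  have ch: "continuous_on S h" for S
    unfolding h_def using G by (intro continuous_intros continuous_on_evalp) auto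
  obtain K where K: "\<And>w. w \<in> C \<Longrightarrow> \<bar>evalp f w\<bar> \<le> K" using bdd by metis
  define D where "D = C \<inter> {w. evalp f w \<le> 0}"
  have "closed {w. evalp f w \<le> 0}"
    by (intro closed_Collect_le continuous_on_evalp continuous_on_const)
  then have cD: "compact D" unfolding D_def by (intro compact_Int_closed cC)
  \<comment> \<open>Where f <= 0 some constraint fails, so h is positive on the compact set D and
    attains a positive minimum there.\<close>
  obtain \<delta> where \<delta>: "\<delta> > 0" "\<And>w. w \<in> D \<Longrightarrow> \<delta> \<le> h w"
  proof (cases "D = {}")
    case True then show ?thesis using that[of 1] by simp
  next
    case False
    then obtain w0 where "w0 \<in> D" "\<And>w. w \<in> D \<Longrightarrow> h w0 \<le> h w"
      using continuous_attains_inf[OF cD _ ch] by metis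
    then show ?thesis using that[of "h w0"] hpos by (auto simp: D_def)
  qed
  \<comment> \<open>On D this makes l h at least |K| + 1, which outweighs f >= -K.\<close>
  define l where "l = (\<bar>K\<bar> + 1) / \<delta>"
  have l: "l > 0" using \<delta> by (simp add: l_def)
  have fl: "0 < evalp f w + l * h w" if w: "w \<in> C" for w
  proof (cases "evalp f w \<le> 0")
    case True
    then have "l * \<delta> \<le> l * h w" using \<delta>(2)[of w] w l by (intro mult_left_mono) (auto simp: D_def)
    moreover have "l * \<delta> = \<bar>K\<bar> + 1" using \<delta> by (simp add: l_def)
    ultimately show ?thesis using K[OF w] by linarith
  next
    case False
    then show ?thesis using h0[of w] l by (simp add: add_pos_nonneg)
  qed
  have "C \<noteq> {}" using C[of 0] c by auto
  moreover have "continuous_on C (\<lambda>w. evalp f w + l * h w)"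
    by (intro continuous_intros ch continuous_on_evalp)
  ultimately obtain w0 where w0: "w0 \<in> C"
    "\<And>w. w \<in> C \<Longrightarrow> evalp f w0 + l * h w0 \<le> evalp f w + l * h w"
    using continuous_attains_inf[OF cC, of "\<lambda>w. evalp f w + l * h w"] by blast
  define \<eta> where "\<eta> = evalp f w0 + l * h w0"
  have \<eta>: "\<eta> > 0" using fl[OF w0(1)] by (simp add: \<eta>_def)
  \<comment> \<open>By \<open>penalty_bound\<close> the subtracted sum is at most l CARD('i) / m - l
    h; this m keeps the first term below the minimum \<open>\<eta>\<close> of f + l h.\<close>
  obtain m where m: "l * real CARD('i) / \<eta> < real m" using reals_Archimedean2 by blast
  have m0: "m > 0"
  proof (rule ccontr)
    assume "\<not> m > 0"
    then have "l * real CARD('i) / \<eta> < 0" using m by simp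
    moreover have "0 \<le> l * real CARD('i) / \<eta>" using l \<eta> by simp
    ultimately show False by simp
  qed
  have lm: "l * (real CARD('i) / real m) < \<eta>" using m m0 \<eta> by (simp add: field_simps)
  define \<sigma> where "\<sigma> i = Const (l / G) * ((1 - Const (1 / G) * g i) ^ m)\<^sup>2" for i
  have \<sigma>: "\<sigma> i \<in> SOS" for i
    unfolding \<sigma>_def using l G by (intro SOS_mult SOS_Const SOS_square) auto
  define q where "q = (\<Sum>i\<in>UNIV. \<sigma> i * g i)"
  have "f - q \<in> QM1 (ball_poly R)"
  proof (rule positive_on_box_in_QM1[OF c])
    fix w :: "real^'v" assume "\<forall>v. \<bar>w $ v\<bar> \<le> c"
    then have w: "w \<in> C" by (simp add: C)
    have "evalp q w = l * (\<Sum>i\<in>UNIV. (evalp (g i) w / G) * ((1 - evalp (g i) w / G) ^ m)\<^sup>2)"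
      unfolding q_def \<sigma>_def by (simp add: sum_distrib_left mult_ac)
    also have "\<dots> \<le> l * (\<Sum>i\<in>UNIV. 1 / real m - max 0 (- (evalp (g i) w / G)))"
      using l G gG[OF w] m0 by (intro mult_left_mono sum_mono penalty_bound) auto
    also have "\<dots> = l * (real CARD('i) / real m) - l * h w"
      by (simp add: sum_subtractf h_def right_diff_distrib)
    finally show "0 < evalp (f - q) w" using lm w0(2)[OF w] unfolding evalp_diff \<eta>_def by linarith
  qed
  then have "f - q \<in> QMod g" using QM1_subset_QMod[OF ball] by blast
  moreover have "q \<in> QMod g"
    unfolding q_def by (intro QMod_sum QMod_SOS_mult QMod_generator \<sigma>)
  ultimately have "(f - q) + q \<in> QMod g" by (rule QMod_add)
  then show ?thesis by simp
qed

section \<open>The Archimedean property for polytopes\<close>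

text \<open>Products of module elements need not lie in the module, but square multiples do: (c +
  X)^2 (c - X) + (c - X)^2 (c + X) = 2 c (c^2 - X^2).\<close>

lemma QMod_bound_square:
  fixes X :: "'v rpoly"
  assumes "Const c1 - X \<in> QMod g" "Const c2 + X \<in> QMod g"
  shows "\<exists>r. Const r - X\<^sup>2 \<in> QMod g"
proof -
  define c where "c = \<bar>c1\<bar> + \<bar>c2\<bar> + 1"
  have c: "c > 0" "c1 \<le> c" "c2 \<le> c" by (auto simp: c_def)
  have "(Const c1 - X) + Const (c - c1) \<in> QMod g" "(Const c2 + X) + Const (c - c2) \<in> QMod g"
    using c by (auto intro!: QMod_add assms QMod_SOS[OF SOS_Const])
  then have *: "Const c - X \<in> QMod g" "Const c + X \<in> QMod g"
    by (simp_all add: Const_diff algebra_simps)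
  have "Const (1 / (2 * c)) * ((Const c + X)\<^sup>2 * (Const c - X) + (Const c - X)\<^sup>2 * (Const c + X)) \<in> QMod g"
    using c by (intro QMod_SOS_mult QMod_add SOS_square * SOS_Const) auto
  also have "(Const c + X)\<^sup>2 * (Const c - X) + (Const c - X)\<^sup>2 * (Const c + X)
      = 2 * Const c * (Const (c\<^sup>2) - X\<^sup>2)"
    unfolding Const_power2 by (simp add: algebra_simps power2_eq_square)
  also have "Const (1 / (2 * c)) * (2 * Const c * (Const (c\<^sup>2) - X\<^sup>2))
      = Const (1 / (2 * c) * of_nat 2 * c) * (Const (c\<^sup>2) - X\<^sup>2)"
    unfolding Const_mult Const_of_nat by (simp add: mult.assoc)
  also have "1 / (2 * c) * of_nat 2 * c = 1" using c by simp
  finally show ?thesis by (auto simp: Const_1)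
qed

lemma ball_poly_in_QMod:
  fixes g :: "'i::finite \<Rightarrow> ('v::finite) rpoly"
  assumes "\<And>v. \<exists>r. Const r - (Var v)\<^sup>2 \<in> QMod g"
  shows "\<exists>R. ball_poly R \<in> QMod g"
proof -
  obtain r where "\<And>v. Const (r v) - (Var v)\<^sup>2 \<in> QMod g" using assms by metis
  then have "(\<Sum>v\<in>UNIV. Const (r v) - (Var v)\<^sup>2) \<in> QMod g" by (intro QMod_sum)
  then have "ball_poly (\<Sum>v\<in>UNIV. r v) \<in> QMod g"
    by (simp add: ball_poly_def sum_subtractf Const_sum)
  then show ?thesis by blast
qed

section \<open>Finitely generated cones that fill the whole space\<close>

definition nonneg_comb :: "('i::finite \<Rightarrow> 'a::real_vector) \<Rightarrow> 'a set" where
  "nonneg_comb u = {\<Sum>i\<in>UNIV. l i *\<^sub>R u i | l. \<forall>i. 0 \<le> l i}"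

lemma nonneg_comb_I: "(\<And>i. 0 \<le> l i) \<Longrightarrow> (\<Sum>i\<in>UNIV. l i *\<^sub>R u i) \<in> nonneg_comb u"
  unfolding nonneg_comb_def by blast

lemma nonneg_comb_scale:
  assumes "x \<in> nonneg_comb u" "0 \<le> t"
  shows "t *\<^sub>R x \<in> nonneg_comb u"
proof -
  obtain l where l: "x = (\<Sum>i\<in>UNIV. l i *\<^sub>R u i)" "\<forall>i. 0 \<le> l i"
    using assms(1) unfolding nonneg_comb_def by blast
  have "t *\<^sub>R x = (\<Sum>i\<in>UNIV. (t * l i) *\<^sub>R u i)"
    unfolding l by (simp add: scaleR_sum_right)
  then show ?thesis using assms(2) l(2) by (simp only:) (intro nonneg_comb_I, auto)
qed

lemma nonneg_comb_generator: "u i \<in> nonneg_comb u"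
proof -
  have "(\<Sum>j\<in>UNIV. (if j = i then 1 else 0) *\<^sub>R u j) = (\<Sum>j\<in>UNIV. if j = i then u j else 0)"
    by (intro sum.cong) auto
  then show ?thesis using nonneg_comb_I[of "\<lambda>j. if j = i then 1 else 0" u] by simp
qed

lemma convex_nonneg_comb: "convex (nonneg_comb u)"
proof (rule convexI)
  fix x y and s t :: real
  assume "x \<in> nonneg_comb u" "y \<in> nonneg_comb u" and st: "0 \<le> s" "0 \<le> t"
  then obtain l k where l: "x = (\<Sum>i\<in>UNIV. l i *\<^sub>R u i)" "\<forall>i. 0 \<le> l i"
    and k: "y = (\<Sum>i\<in>UNIV. k i *\<^sub>R u i)" "\<forall>i. 0 \<le> k i"
    unfolding nonneg_comb_def by blast
  have "s *\<^sub>R x + t *\<^sub>R y = (\<Sum>i\<in>UNIV. (s * l i + t * k i) *\<^sub>R u i)"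
    unfolding l k by (simp add: scaleR_sum_right scaleR_add_left sum.distrib)
  then show "s *\<^sub>R x + t *\<^sub>R y \<in> nonneg_comb u"
    using st l(2) k(2) by (simp only:) (intro nonneg_comb_I, auto)
qed

text \<open>If the cone misses a point, a separating normal v has
  \<open>u i \<bullet> v \<le> 0\<close> for all i. It is then a nonzero recession direction of the
  nonempty polyhedron, against boundedness.\<close>

lemma nonneg_comb_UNIV_of_bounded:
  fixes u :: "'i::finite \<Rightarrow> 'a::euclidean_space"
  assumes bdd: "bounded {x. \<forall>i. u i \<bullet> x \<le> b i}" and ne: "{x. \<forall>i. u i \<bullet> x \<le> b i} \<noteq> {}"
  shows "nonneg_comb u = UNIV"
proof (rule ccontr)
  assume "nonneg_comb u \<noteq> UNIV"
  then obtain y where y: "y \<notin> nonneg_comb u" by blast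
  have "\<exists>v t. v \<noteq> 0 \<and> (\<forall>x\<in>nonneg_comb u. v \<bullet> x \<le> t) \<and> (\<forall>x\<in>{y}. v \<bullet> x \<ge> t)"
    using y nonneg_comb_generator[of u]
    by (intro separating_hyperplane_sets convex_nonneg_comb convex_singleton) auto
  then obtain v t where v: "v \<noteq> 0" "\<And>x. x \<in> nonneg_comb u \<Longrightarrow> v \<bullet> x \<le> t" by blast
  have vu: "u i \<bullet> v \<le> 0" for i
  proof (rule ccontr)
    assume "\<not> u i \<bullet> v \<le> 0"
    then have p: "v \<bullet> u i > 0" by (simp add: inner_commute)
    \<comment> \<open>Scaled so that v takes the value |t| + 1 > t at a point of the cone.\<close>
    let ?s = "(\<bar>t\<bar> + 1) / (v \<bullet> u i)"
    have "v \<bullet> (?s *\<^sub>R u i) \<le> t"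
      using p by (intro v(2) nonneg_comb_scale nonneg_comb_generator) auto
    then show False using p by simp
  qed
  obtain x0 where x0: "\<And>i. u i \<bullet> x0 \<le> b i" using ne by auto
  obtain M where M: "\<And>x. (\<forall>i. u i \<bullet> x \<le> b i) \<Longrightarrow> norm x \<le> M"
    using bdd by (auto simp: bounded_iff)
  \<comment> \<open>A step of this length from x0 along v leaves the ball of radius M.\<close>
  define s where "s = (M + norm x0 + 1) / norm v"
  have "M \<ge> 0" using M[of x0] x0 norm_ge_zero[of x0] by (meson order_trans)
  then have s: "s \<ge> 0" unfolding s_def by simp
  have "norm (x0 + s *\<^sub>R v) \<le> M"
  proof (rule M, rule allI)
    fix i
    have "s * (u i \<bullet> v) \<le> 0" using s vu[of i] by (rule mult_nonneg_nonpos)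
    then show "u i \<bullet> (x0 + s *\<^sub>R v) \<le> b i" using x0[of i] by (simp add: inner_add_right)
  qed
  moreover have "norm (s *\<^sub>R v) = M + norm x0 + 1" using v(1) \<open>M \<ge> 0\<close> s by (simp add: s_def)
  ultimately show False using norm_triangle_ineq4[of "x0 + s *\<^sub>R v" x0] by simp
qed

lemma nonneg_comb_UNIV_of_interior:
  fixes u :: "'i::finite \<Rightarrow> 'a::real_normed_vector"
  assumes "0 \<in> interior (convex hull (range u))"
  shows "nonneg_comb u = UNIV"
proof -
  have sub: "convex hull (range u) \<subseteq> nonneg_comb u"
    by (rule hull_minimal) (auto simp: convex_nonneg_comb nonneg_comb_generator)
  obtain e where e: "e > 0" "ball 0 e \<subseteq> convex hull (range u)"
    using assms by (auto simp: mem_interior)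
  have "y \<in> nonneg_comb u" for y
  proof -
    \<comment> \<open>Shrinks y into the ball of radius e; the added 1 covers y = 0.\<close>
    define t where "t = e / (2 * (norm y + 1))"
    have t: "t > 0" using e by (simp add: t_def add_nonneg_pos)
    have "t * norm y < e"
    proof -
      have "t * norm y \<le> t * (norm y + 1)" using t by simp
      also have "\<dots> = e / 2"
      proof -
        have "norm y + 1 \<noteq> 0" using norm_ge_zero[of y] by linarith
        then show ?thesis unfolding t_def mult_2 by (simp add: field_simps)
      qed
      finally show ?thesis using e by simp
    qed
    then have "t *\<^sub>R y \<in> nonneg_comb u" using t e sub by (auto simp: subset_iff)
    then have "(1 / t) *\<^sub>R (t *\<^sub>R y) \<in> nonneg_comb u"
      by (rule nonneg_comb_scale) (use t in simp)
    then show ?thesis using t by simp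
  qed
  then show ?thesis by blast
qed

text \<open>Writing y as a nonnegative combination of the \<open>u i\<close>, the same combination
  of the generators has linear part y, and nonnegative constants are sums of squares.
  \<open>X\<close> is arbitrary so that it can stand for the x block or the z block.\<close>

lemma affine_bound_in_QMod:
  fixes u :: "'k::finite \<Rightarrow> real^'d" and X :: "'d \<Rightarrow> 'v rpoly"
  assumes g: "\<And>i. Const (b i) - (\<Sum>m\<in>UNIV. Const (u i $ m) * X m) \<in> QMod g"
    and u: "nonneg_comb u = UNIV"
  shows "\<exists>r. Const r - (\<Sum>m\<in>UNIV. Const (y $ m) * X m) \<in> QMod g"
proof -
  obtain l where l: "y = (\<Sum>i\<in>UNIV. l i *\<^sub>R u i)" "\<And>i. 0 \<le> l i"
    using u unfolding nonneg_comb_def by blast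
  have "(\<Sum>i\<in>UNIV. Const (l i) * (Const (b i) - (\<Sum>m\<in>UNIV. Const (u i $ m) * X m))) \<in> QMod g"
    by (intro QMod_sum QMod_SOS_mult SOS_Const l g)
  also have "(\<Sum>i\<in>UNIV. Const (l i) * (Const (b i) - (\<Sum>m\<in>UNIV. Const (u i $ m) * X m)))
     = Const (\<Sum>i\<in>UNIV. l i * b i) - (\<Sum>i\<in>UNIV. \<Sum>m\<in>UNIV. Const (l i * u i $ m) * X m)"
    by (simp add: Const_sum Const_mult right_diff_distrib sum_subtractf sum_distrib_left mult.assoc)
  also have "(\<Sum>i\<in>UNIV. \<Sum>m\<in>UNIV. Const (l i * u i $ m) * X m) = (\<Sum>m\<in>UNIV. Const (y $ m) * X m)"
    by (subst sum.swap) (simp add: l(1) Const_sum sum_distrib_right)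
  finally show ?thesis by blast
qed

text \<open>The directions \<open>axis m 1\<close> and \<open>axis m (- 1)\<close> bound
  \<open>X m\<close> from both sides, and \<open>QMod_bound_square\<close> combines the two
  bounds.\<close>

lemma coordinate_square_bound_in_QMod:
  fixes u :: "'k::finite \<Rightarrow> real^'d" and X :: "'d \<Rightarrow> 'v rpoly"
  assumes g: "\<And>i. Const (b i) - (\<Sum>m\<in>UNIV. Const (u i $ m) * X m) \<in> QMod g"
    and u: "nonneg_comb u = UNIV"
  shows "\<exists>r. Const r - (X m)\<^sup>2 \<in> QMod g"
proof -
  have ax: "(\<Sum>k\<in>UNIV. Const (axis m e $ k) * X k) = Const e * X m" for e
  proof -
    have "(\<Sum>k\<in>UNIV. Const (axis m e $ k) * X k) = (\<Sum>k\<in>UNIV. if k = m then Const e * X k else 0)"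
      by (intro sum.cong) (auto simp: axis_def Const_0)
    then show ?thesis by simp
  qed
  obtain c1 c2 where "Const c1 - Const 1 * X m \<in> QMod g" "Const c2 - Const (- 1) * X m \<in> QMod g"
    using affine_bound_in_QMod[OF g u, of "axis m 1"] affine_bound_in_QMod[OF g u, of "axis m (- 1)"]
    unfolding ax by blast
  moreover have "Const (- 1) = (- 1 :: 'v rpoly)" by (simp add: Const_def single_uminus)
  ultimately show ?thesis using QMod_bound_square[of c1 "X m" g c2] by (simp add: Const_1)
qed

section \<open>The containment hierarchy\<close>

lemma QM_mono: "s \<le> t \<Longrightarrow> QM s a A B \<subseteq> QM t a A B"
  unfolding QM_def by (auto 4 4 intro: le_trans)

lemma QM_subset_QMod: "QM t a A B \<subseteq> QMod (gen a A B)"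
  unfolding QM_def QMod_def by blast

lemma QMod_subset_Union_QM: "QMod (gen a A B) \<subseteq> (\<Union>t. QM t a A B)"
proof
  fix p assume "p \<in> QMod (gen a A B)"
  then obtain s0 s where s: "p = s0 + (\<Sum>i\<in>UNIV. s i * gen a A B i)" "s0 \<in> SOS" "\<forall>i. s i \<in> SOS"
    by (rule QMod_E)
  \<comment> \<open>A certificate has finitely many terms, and the sum of their degrees bounds each
    one.\<close>
  define t where "t = total_degree s0 + (\<Sum>i\<in>UNIV. total_degree (s i * gen a A B i))"
  have "total_degree (s i * gen a A B i) \<le> (\<Sum>i\<in>UNIV. total_degree (s i * gen a A B i))" for i
    by (rule member_le_sum) auto
  then have "total_degree (s i * gen a A B i) \<le> 2 * t" for i
    unfolding t_def by (rule order_trans) simp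
  moreover have "total_degree s0 \<le> 2 * t" by (simp add: t_def)
  ultimately have "p \<in> QM t a A B"
    unfolding QM_def s(1) mem_Collect_eq by (intro exI[of _ s0] exI[of _ s]) (simp add: s(2,3))
  then show "p \<in> (\<Union>t. QM t a A B)" by blast
qed

definition join :: "real^'d \<Rightarrow> real^'d \<Rightarrow> real^('d + 'd)" where
  "join x z = (\<chi> v. case v of Inl m \<Rightarrow> x $ m | Inr m \<Rightarrow> z $ m)"

lemma join_nth [simp]: "join x z $ Inl m = x $ m" "join x z $ Inr m = z $ m"
  by (simp_all add: join_def)

lemma join_surj: "w = join (\<chi> m. w $ Inl m) (\<chi> m. w $ Inr m)"
  by (simp add: vec_eq_iff join_def split: sum.split)

lemma evalp_bilin: "evalp bilin (join x z) = x \<bullet> z"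
  by (simp add: bilin_def inner_vec_def)

lemma evalp_gen_nonneg_iff:
  "(\<forall>i. 0 \<le> evalp (gen a A B i) (join x z)) \<longleftrightarrow> x \<in> polyP a A \<and> z \<in> polarQ B"
proof -
  have "(\<forall>i. 0 \<le> evalp (gen a A B i) (join x z)) \<longleftrightarrow>
    (\<forall>i. 0 \<le> evalp (gen a A B (Inl i)) (join x z)) \<and> (\<forall>j. 0 \<le> evalp (gen a A B (Inr j)) (join x z))"
    by (metis sum.exhaust)
  then show ?thesis
    by (simp add: polyP_def polarQ_def less_eq_vec_def matrix_vector_mult_def transpose_def)
qed

lemma columns_eq_range: "columns B = range (\<lambda>j. column j B)"
  by (auto simp: columns_def)

lemma archimedean_gen:
  fixes a :: "real^'k" and A :: "real^'d^'k" and B :: "real^'l^'d"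
  assumes "bounded (polyP a A)" "polyP a A \<noteq> {}" "0 \<in> interior (polyQ B)"
  shows "\<exists>R. ball_poly R \<in> QMod (gen a A B)"
proof (rule ball_poly_in_QMod)
  fix v :: "'d + 'd"
  have P: "polyP a A = {x. \<forall>i. row i A \<bullet> x \<le> a $ i}"
    by (auto simp: polyP_def less_eq_vec_def matrix_vector_mult_def row_def inner_vec_def)
  have "nonneg_comb (\<lambda>i. row i A) = UNIV"
    using assms(1,2) unfolding P by (rule nonneg_comb_UNIV_of_bounded)
  then have x: "\<exists>r. Const r - (Var (Inl m))\<^sup>2 \<in> QMod (gen a A B)" for m
    using coordinate_square_bound_in_QMod[of "\<lambda>i. a $ i" "\<lambda>i. row i A" "\<lambda>m. Var (Inl m)" "gen a A B" m]
      QMod_generator[of "gen a A B" "Inl _"] by (simp add: row_def)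
  have "nonneg_comb (\<lambda>j. column j B) = UNIV"
    using assms(3) unfolding polyQ_def columns_eq_range by (rule nonneg_comb_UNIV_of_interior)
  then have z: "\<exists>r. Const r - (Var (Inr m))\<^sup>2 \<in> QMod (gen a A B)" for m
    using coordinate_square_bound_in_QMod[of "\<lambda>_. 1" "\<lambda>j. column j B" "\<lambda>m. Var (Inr m)" "gen a A B" m]
      QMod_generator[of "gen a A B" "Inr _"] by (simp add: column_def)
  show "\<exists>r. Const r - (Var v)\<^sup>2 \<in> QMod (gen a A B)"
    using x z by (cases v) auto
qed

section \<open>Polarity between Q and its polar\<close>

lemma polarQ_iff: "z \<in> polarQ B \<longleftrightarrow> (\<forall>q\<in>polyQ B. q \<bullet> z \<le> 1)"
proof -
  have "z \<in> polarQ B \<longleftrightarrow> (\<forall>q\<in>columns B. q \<bullet> z \<le> 1)"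
    by (auto simp: polarQ_def less_eq_vec_def matrix_vector_mult_def transpose_def columns_eq_range
        column_def inner_vec_def)
  also have "\<dots> \<longleftrightarrow> columns B \<subseteq> {q. z \<bullet> q \<le> 1}" by (auto simp: inner_commute)
  also have "\<dots> \<longleftrightarrow> polyQ B \<subseteq> {q. z \<bullet> q \<le> 1}"
    unfolding polyQ_def using hull_minimal[of _ _ convex] hull_subset[of "columns B" convex]
      convex_halfspace_le[of z 1] by (metis subset_trans)
  also have "\<dots> \<longleftrightarrow> (\<forall>q\<in>polyQ B. q \<bullet> z \<le> 1)" by (auto simp: inner_commute)
  finally show ?thesis .
qed

text \<open>A point outside the closed convex set Q is cut off by a hyperplane, which normalizes to
  an element of the polar violating the bound 1.\<close>

lemma bipolar_polyQ:
  assumes "0 \<in> polyQ B" and "\<And>z. z \<in> polarQ B \<Longrightarrow> x \<bullet> z \<le> 1"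
  shows "x \<in> polyQ B"
proof (rule ccontr)
  assume x: "x \<notin> polyQ B"
  have "compact (polyQ B)"
    unfolding polyQ_def columns_eq_range by (intro finite_imp_compact_convex_hull) auto
  then have "closed (polyQ B)" by (rule compact_imp_closed)
  moreover have "convex (polyQ B)" by (simp add: polyQ_def)
  ultimately obtain v b where v: "v \<bullet> x < b" "\<forall>q\<in>polyQ B. b < v \<bullet> q"
    using separating_hyperplane_closed_point[OF _ _ x] by blast
  have b: "b < 0" using v(2) assms(1) by force
  \<comment> \<open>As 0 lies in Q, b is negative, so dividing by it reverses both strict
    inequalities: values on Q fall below 1, the value at x rises above 1.\<close>
  define z where "z = (1 / b) *\<^sub>R v"
  have "z \<in> polarQ B"
    unfolding polarQ_iff
  proof
    fix q assume "q \<in> polyQ B"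
    then have "b < v \<bullet> q" using v(2) by blast
    then show "q \<bullet> z \<le> 1" using b by (simp add: z_def inner_commute divide_le_eq)
  qed
  then have "x \<bullet> z \<le> 1" by (rule assms(2))
  then show False using v(1) b by (simp add: z_def inner_commute divide_le_eq)
qed

section \<open>Bounds and convergence of the hierarchy\<close>

lemma mu_star_le_mu: "mu_star a A B \<le> mu a A B t"
  unfolding mu_star_def mu_def
proof (rule SUP_least, rule Inf_greatest)
  fix y xz
  assume "xz \<in> polyP a A \<times> polarQ B" and "y \<in> {ereal \<mu> |\<mu>. Const \<mu> - bilin \<in> QM t a A B}"
  then obtain x z \<mu> where xz: "xz = (x, z)" "x \<in> polyP a A" "z \<in> polarQ B"
    and y: "y = ereal \<mu>" "Const \<mu> - bilin \<in> QM t a A B" by blast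
  \<comment> \<open>A certificate is nonnegative at every feasible point, so each admissible
    \<open>\<mu>\<close> bounds the bilinear form there.\<close>
  have "0 \<le> evalp (Const \<mu> - bilin) (join x z)"
    using evalp_QMod[of _ "gen a A B"] QM_subset_QMod y(2) xz evalp_gen_nonneg_iff by blast
  then show "(case xz of (x, z) \<Rightarrow> ereal (x \<bullet> z)) \<le> y"
    using xz(1) y(1) by (simp add: evalp_bilin)
qed

lemma decseq_mu: "decseq (mu a A B)"
  unfolding decseq_def mu_def using QM_mono by (intro allI impI Inf_superset_mono) blast

lemma mu_tendsto_mu_star:
  assumes "bounded (polyP a A)" "polyP a A \<noteq> {}" "0 \<in> interior (polyQ B)"
  shows "mu a A B \<longlonglongrightarrow> mu_star a A B"
proof -
  obtain R where R: "ball_poly R \<in> QMod (gen a A B)" using archimedean_gen[OF assms] by blast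
  have "(INF t. mu a A B t) \<le> ereal y" if y: "mu_star a A B < ereal y" for y
  proof -
    have "Const y - bilin \<in> QMod (gen a A B)"
    proof (rule putinar[OF R])
      fix w assume w: "\<forall>i. 0 \<le> evalp (gen a A B i) w"
      define x z where "x = (\<chi> m. w $ Inl m)" and "z = (\<chi> m. w $ Inr m)"
      have wj: "w = join x z" unfolding x_def z_def by (rule join_surj)
      have "(x, z) \<in> polyP a A \<times> polarQ B" using w evalp_gen_nonneg_iff wj by blast
      then have "ereal (x \<bullet> z) \<le> mu_star a A B" unfolding mu_star_def by (force intro: SUP_upper2)
      then have "ereal (x \<bullet> z) < ereal y" using y by (rule le_less_trans)
      then show "0 < evalp (Const y - bilin) w" by (simp add: wj evalp_bilin)
    qed
    then obtain t where "Const y - bilin \<in> QM t a A B" using QMod_subset_Union_QM by blast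
    then have "mu a A B t \<le> ereal y" unfolding mu_def by (intro Inf_lower) blast
    then show ?thesis by (rule INF_lower2[OF UNIV_I])
  qed
  then have "(INF t. mu a A B t) \<le> mu_star a A B"
    \<comment> \<open>Otherwise a real y would lie strictly between \<open>mu_star\<close> and the
      infimum, contradicting the bound just shown.\<close>
    using ereal_dense2[of "mu_star a A B" "INF t. mu a A B t"] by (meson leD leI)
  moreover have "mu_star a A B \<le> (INF t. mu a A B t)" by (rule INF_greatest) (rule mu_star_le_mu)
  ultimately have "(INF t. mu a A B t) = mu_star a A B" by (rule antisym)
  with LIMSEQ_INF[OF decseq_mu[of a A B]] show ?thesis by simp
qed

text \<open>Compactness gives P a uniform margin inside Q, so (1 + d) x stays in Q for one fixed d >
  0 and all x in P. Pairing with the polar gives the bound 1 / (1 + d).\<close>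

lemma mu_star_less_1:
  assumes "compact (polyP a A)" "strongly_contained (polyP a A) (polyQ B)"
  shows "mu_star a A B < 1"
proof -
  have sub: "polyP a A \<subseteq> polyQ B" and fr: "frontier (polyP a A) \<inter> frontier (polyQ B) = {}"
    using assms(2) by (auto simp: strongly_contained_def)
  \<comment> \<open>A point of P outside the interior of Q is on the frontier of Q; it is not
    interior to P either, so it would lie on both frontiers.\<close>
  have "polyP a A \<subseteq> interior (polyQ B)"
    using fr sub interior_mono[OF sub] closure_subset[of "polyP a A"] closure_subset[of "polyQ B"]
    unfolding frontier_def by blast
  then obtain e where e: "e > 0" "(\<Union>x\<in>polyP a A. ball x e) \<subseteq> interior (polyQ B)"
    using compact_subset_open_imp_ball_epsilon_subset[OF assms(1) open_interior] by blast
  obtain M where M: "M > 0" "\<And>x. x \<in> polyP a A \<Longrightarrow> norm x \<le> M"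
    using compact_imp_bounded[OF assms(1)] by (auto simp: bounded_pos)
  \<comment> \<open>Since norms on P are at most M, moving from x to (1 + d) x shifts it by at most
    e / 2.\<close>
  define d where "d = e / (2 * M)"
  have d: "d > 0" using e M by (simp add: d_def)
  have "mu_star a A B \<le> ereal (1 / (1 + d))"
    unfolding mu_star_def
  proof (rule SUP_least)
    fix xz assume "xz \<in> polyP a A \<times> polarQ B"
    then obtain x z where xz: "xz = (x, z)" "x \<in> polyP a A" "z \<in> polarQ B" by blast
    have "d * norm x \<le> d * M" using d M(2)[OF xz(2)] by (intro mult_left_mono) auto
    also have "\<dots> < e" using M(1) e(1) by (simp add: d_def)
    finally have "x + d *\<^sub>R x \<in> ball x e" using d by (simp add: dist_norm)
    then have "x + d *\<^sub>R x \<in> polyQ B" using e(2) xz(2) interior_subset by blast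
    then have "(x + d *\<^sub>R x) \<bullet> z \<le> 1" using xz(3) polarQ_iff by blast
    then have "(1 + d) * (x \<bullet> z) \<le> 1" by (simp add: inner_add_left algebra_simps)
    then have "x \<bullet> z \<le> 1 / (1 + d)" using d by (simp add: field_simps)
    then show "(case xz of (x, z) \<Rightarrow> ereal (x \<bullet> z)) \<le> ereal (1 / (1 + d))" using xz(1) by simp
  qed
  also have "\<dots> < 1" using d by simp
  finally show ?thesis .
qed

theorem theorem4p2:
  fixes a :: "real^'k" and A :: "real^'d^'k" and B :: "real^'l^'d"
  assumes "polytope (polyP a A)" and "polyP a A \<noteq> {}"
    and "0 \<in> interior (polyQ B)"
  shows "(\<forall>t\<ge>2. mu a A B t \<le> 1 \<longrightarrow> polyP a A \<subseteq> polyQ B)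
    \<and> ((\<forall>t. mu_star a A B \<le> mu a A B t) \<and> decseq (mu a A B)
        \<and> mu a A B \<longlonglongrightarrow> mu_star a A B)
    \<and> (strongly_contained (polyP a A) (polyQ B) \<longrightarrow> (\<exists>t\<ge>2. mu a A B t \<le> 1))"
proof (intro conjI allI impI)
  fix t assume "mu a A B t \<le> 1"
  then have 1: "mu_star a A B \<le> 1" using mu_star_le_mu order_trans by blast
  show "polyP a A \<subseteq> polyQ B"
  proof
    fix x assume x: "x \<in> polyP a A"
    show "x \<in> polyQ B"
    proof (rule bipolar_polyQ)
      show "0 \<in> polyQ B" using assms(3) interior_subset by blast
      fix z assume "z \<in> polarQ B"
      with x have "ereal (x \<bullet> z) \<le> mu_star a A B" unfolding mu_star_def by (force intro: SUP_upper2)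
      then have "ereal (x \<bullet> z) \<le> 1" using 1 by (rule order_trans)
      then show "x \<bullet> z \<le> 1" by simp
    qed
  qed
next
  show lim: "mu a A B \<longlonglongrightarrow> mu_star a A B"
    using assms polytope_imp_bounded by (intro mu_tendsto_mu_star)
  assume "strongly_contained (polyP a A) (polyQ B)"
  then have "mu_star a A B < 1" using assms(1) polytope_imp_compact by (intro mu_star_less_1)
  \<comment> \<open>The limit is strictly below 1, so some finite level already gets below 1; the
    maximum with 2 respects the required lower bound on t.\<close>
  from order_tendstoD(2)[OF lim this] obtain T where "\<And>t. t \<ge> T \<Longrightarrow> mu a A B t < 1"
    by (auto simp: eventually_sequentially)
  then have "mu a A B (max T 2) \<le> 1" by (simp add: less_imp_le)
  then show "\<exists>t\<ge>2. mu a A B t \<le> 1" by (intro exI[of _ "max T 2"]) simp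
qed (rule mu_star_le_mu decseq_mu)+

end
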